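(* Let $(X,\varphi)$ be an $N$-dimensional Lattice EDS, let $u\in X$ be non-stationary, write $u(t)=\varphi(u,t)$, and let $T>0$. For $R\in\mathbb{N}$, $R\ge 1$, and $t\geq 0$ put $E(R,t)=\sum_{\alpha\in C^*(R)} e_{u(t)}(\alpha)$, where $C^*(R)=\{\alpha\in\mathbb{Z}^N: -R+1\le \alpha_j\le R,\ j=1,\dots,N\}$, and let $$J_T=\{R\in\mathbb{N},\ R\ge 1:\ E(R,T)\ge E(R,0)\}.$$ (i) If $N=1$, then $J_T$ is finite. (ii) If $N=2$, then $\sum_{r\in J_T} 1/r$ is finite.
   Context: Notation: $\varepsilon_1,\dots,\varepsilon_N$ is the standard basis of $\mathbb{Z}^N$; for $v:\mathbb{Z}^N\to\mathbb{R}^N$, $\operatorname{div} v(\alpha)=\sum_{j=1}^N \big(v_j(\alpha)-v_j(\alpha-\varepsilon_j)\big)$; $l_\infty(\mathbb{Z}^N)$ is the space of bounded functions $\mathbb{Z}^N\to\mathbb{R}$ with sup-norm $\|\cdot\|_\infty$; $\mathbb{R}^+=[0,\infty)$. Definition (Lattice EDS). Let $X$ be a metrizable space and $\varphi$ a continuous semiflow on $X$; write $u(t)=\varphi(u,t)$, $t\ge 0$. A point $u\in X$ is stationary (an equilibrium) if $\varphi(u,t)=u$ for all $t\ge 0$. $(X,\varphi)$ is an $N$-dimensional extended dissipative system on a lattice (Lattice EDS) if there are functions $e,d,f_1,\dots,f_N:X\to l_\infty(\mathbb{Z}^N)$ (energy, dissipation, flux $f=(f_1,\dots,f_N)$), written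 $u\mapsto e_u,d_u,f_u$, fixed once and for all, such that: (A1) $e_u(\alpha)\ge 0$, $d_u(\alpha)\geq 0$ for all $u\in X$, $\alpha\in\mathbb{Z}^N$. (A2) For each $\alpha$, the maps $u\mapsto e_u(\alpha),d_u(\alpha),(f_1)_u(\alpha),\dots,(f_N)_u(\alpha)$ are continuous $X\to\mathbb{R}$; and for each $u\in X$ the maps $t\mapsto\|e_{u(t)}\|_\infty,\|d_{u(t)}\|_\infty,\|f_{u(t)}\|_\infty$ are continuous $\mathbb{R}^+\to\mathbb{R}^+$. (A3) If $d_u\equiv 0$ then $u$ is stationary. (A4) Along each semiorbit $u(t)$ and at each $\alpha$, $\partial_t e_{u(t)}(\alpha)=-d_{u(t)}(\alpha)+\operatorname{div} f_{u(t)}(\alpha)$, with $\partial_t$ in the sense of distributions. (A5) There is a non-decreasing $b:\mathbb{R}^+\to\mathbb{R}^+$ such that $|f_u(\alpha)|^2\le b(\|e_u\|_\infty)\, d_u(\alpha)$ for all $u\in X$, $\alpha\in\mathbb{Z}^N$. *)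

theory Defs
  imports "HOL-Analysis.Analysis"
begin

text \<open>
  The lattice \<open>\<int>\<^sup>N\<close> is the type \<^typ>\<open>int ^ 'n\<close> with \<open>N = CARD('n)\<close>; vector-valued functions on it
  take values in \<^typ>\<open>real ^ 'n\<close> with the Euclidean norm.
\<close>

definition sup_norm :: "('i \<Rightarrow> 'v::real_normed_vector) \<Rightarrow> real" where
  "sup_norm g = (SUP \<alpha>. norm (g \<alpha>))"

definition lattice_div :: "(int ^ 'n \<Rightarrow> real ^ 'n) \<Rightarrow> int ^ 'n \<Rightarrow> real" where
  "lattice_div v \<alpha> = (\<Sum>j\<in>UNIV. v \<alpha> $ j - v (\<alpha> - axis j 1) $ j)"

definition continuous_semiflow :: "'a topology \<Rightarrow> ('a \<Rightarrow> real \<Rightarrow> 'a) \<Rightarrow> bool" where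
  "continuous_semiflow X \<phi> \<longleftrightarrow>
     continuous_map (prod_topology X (top_of_set {0..})) X (\<lambda>(u, t). \<phi> u t) \<and>
     (\<forall>u\<in>topspace X. \<phi> u 0 = u) \<and>
     (\<forall>u\<in>topspace X. \<forall>s\<ge>0. \<forall>t\<ge>0. \<phi> u (s + t) = \<phi> (\<phi> u s) t)"

definition stationary :: "('a \<Rightarrow> real \<Rightarrow> 'a) \<Rightarrow> 'a \<Rightarrow> bool" where
  "stationary \<phi> u \<longleftrightarrow> (\<forall>t\<ge>0. \<phi> u t = u)"

text \<open>Smooth functions with compact support in \<open>(0, \<infinity>)\<close>, extended by zero to the real line.\<close>

definition test_function :: "(real \<Rightarrow> real) \<Rightarrow> bool" where
  "test_function \<psi> \<longleftrightarrow>
     (\<forall>k. (deriv ^^ k) \<psi> differentiable_on UNIV) \<and>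
     compact (closure {t. \<psi> t \<noteq> 0}) \<and> closure {t. \<psi> t \<noteq> 0} \<subseteq> {0<..}"

text \<open>\<open>g' = h\<close> in the sense of distributions on \<open>(0, \<infinity>)\<close>.\<close>

definition has_distributional_derivative :: "(real \<Rightarrow> real) \<Rightarrow> (real \<Rightarrow> real) \<Rightarrow> bool" where
  "has_distributional_derivative g h \<longleftrightarrow>
     (\<forall>\<psi>. test_function \<psi> \<longrightarrow>
        - (LBINT t:{0<..}. g t * deriv \<psi> t) = (LBINT t:{0<..}. h t * \<psi> t))"

text \<open>
  The integrals occurring in \<open>A4\<close> always exist: by \<open>A2\<close> and continuity of the semiflow, the
  integrands are continuous with compact support in \<open>(0, \<infinity>)\<close>.
\<close>

locale lattice_EDS =
  fixes X :: "'a topology"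
    and \<phi> :: "'a \<Rightarrow> real \<Rightarrow> 'a"
    and e d :: "'a \<Rightarrow> int ^ 'n \<Rightarrow> real"
    and f :: "'a \<Rightarrow> int ^ 'n \<Rightarrow> real ^ 'n"
  assumes metrizable: "metrizable_space X"
    and semiflow: "continuous_semiflow X \<phi>"
    and bounded_e: "\<And>u. u \<in> topspace X \<Longrightarrow> bounded (range (e u))"
    and bounded_d: "\<And>u. u \<in> topspace X \<Longrightarrow> bounded (range (d u))"
    and bounded_f: "\<And>u. u \<in> topspace X \<Longrightarrow> bounded (range (f u))"
    and A1: "\<And>u \<alpha>. u \<in> topspace X \<Longrightarrow> e u \<alpha> \<ge> 0 \<and> d u \<alpha> \<ge> 0"
    and A2_e: "\<And>\<alpha>. continuous_map X euclideanreal (\<lambda>u. e u \<alpha>)"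
    and A2_d: "\<And>\<alpha>. continuous_map X euclideanreal (\<lambda>u. d u \<alpha>)"
    and A2_f: "\<And>\<alpha> j. continuous_map X euclideanreal (\<lambda>u. f u \<alpha> $ j)"
    and A2_norm_e: "\<And>u. u \<in> topspace X \<Longrightarrow> continuous_on {0..} (\<lambda>t. sup_norm (e (\<phi> u t)))"
    and A2_norm_d: "\<And>u. u \<in> topspace X \<Longrightarrow> continuous_on {0..} (\<lambda>t. sup_norm (d (\<phi> u t)))"
    and A2_norm_f: "\<And>u. u \<in> topspace X \<Longrightarrow> continuous_on {0..} (\<lambda>t. sup_norm (f (\<phi> u t)))"
    and A3: "\<And>u. u \<in> topspace X \<Longrightarrow> (\<forall>\<alpha>. d u \<alpha> = 0) \<Longrightarrow> stationary \<phi> u"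
    and A4: "\<And>u \<alpha>. u \<in> topspace X \<Longrightarrow>
               has_distributional_derivative (\<lambda>t. e (\<phi> u t) \<alpha>)
                 (\<lambda>t. - d (\<phi> u t) \<alpha> + lattice_div (f (\<phi> u t)) \<alpha>)"
    and A5: "\<exists>b :: real \<Rightarrow> real. mono_on {0..} b \<and> (\<forall>x\<ge>0. b x \<ge> 0) \<and>
               (\<forall>u\<in>topspace X. \<forall>\<alpha>. (norm (f u \<alpha>))\<^sup>2 \<le> b (sup_norm (e u)) * d u \<alpha>)"

definition lattice_cube :: "nat \<Rightarrow> (int ^ 'n) set" where
  "lattice_cube R = {\<alpha>. \<forall>j. - int R + 1 \<le> \<alpha> $ j \<and> \<alpha> $ j \<le> int R}"

definition cube_energy ::
    "('a \<Rightarrow> real \<Rightarrow> 'a) \<Rightarrow> ('a \<Rightarrow> int ^ 'n \<Rightarrow> real) \<Rightarrow> 'a \<Rightarrow> nat \<Rightarrow> real \<Rightarrow> real" where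
  "cube_energy \<phi> e u R t = (\<Sum>\<alpha>\<in>lattice_cube R. e (\<phi> u t) \<alpha>)"

definition nondecreasing_radii ::
    "('a \<Rightarrow> real \<Rightarrow> 'a) \<Rightarrow> ('a \<Rightarrow> int ^ 'n \<Rightarrow> real) \<Rightarrow> 'a \<Rightarrow> real \<Rightarrow> nat set" where
  "nondecreasing_radii \<phi> e u T = {R. R \<ge> 1 \<and> cube_energy \<phi> e u R T \<ge> cube_energy \<phi> e u R 0}"

lemma finite_lattice_cube: "finite (lattice_cube R :: (int ^ 'n) set)"
proof -
  have "lattice_cube R \<subseteq> vec_lambda ` (UNIV \<rightarrow>\<^sub>E {- int R + 1..int R} :: ('n \<Rightarrow> int) set)"
  proof
    fix \<alpha> :: "int ^ 'n" assume "\<alpha> \<in> lattice_cube R"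
    then have "vec_nth \<alpha> \<in> UNIV \<rightarrow>\<^sub>E {- int R + 1..int R}"
      by (auto simp: lattice_cube_def)
    then show "\<alpha> \<in> vec_lambda ` (UNIV \<rightarrow>\<^sub>E {- int R + 1..int R} :: ('n \<Rightarrow> int) set)"
      by (metis imageI vec_nth_inverse)
  qed
  then show ?thesis
    by (rule finite_subset) (intro finite_imageI finite_PiE; simp)
qed

end

theory Submission
  imports Defs
begin

text \<open>
  Let \<open>a R\<close> be the dissipation in the cube of radius \<open>R\<close>, integrated over \<open>{0..T}\<close>. If the energy of this cube
  has not decreased, then \<open>a R\<close> is at most the integrated flux through the boundary of the cube. The flux is
  bounded by the square root of the dissipation, so if \<open>S R\<close> is the cardinality of the shell between
  the cubes of radii \<open>R - 1\<close> and \<open>R + 1\<close>, then \<open>(a R)\<^sup>2 \<le> K * S R * (a (R + 1) - a (R - 1))\<close>. The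
  increment is itself \<open>O(S R)\<close>. For \<open>N = 1\<close>, where \<open>S R = 4\<close>, infinitely many such radii would make \<open>a\<close>
  bounded, hence its increments null, although they are bounded below at these radii. For \<open>N = 2\<close>,
  where \<open>S R = 16 R\<close>, the inequality bounds \<open>1 / R\<close> by a telescoping sequence.
\<close>

section \<open>Distributional derivatives of continuous functions\<close>

text \<open>Derivatives are existential witnesses rather than iterates of \<open>deriv\<close>, so a
  closure property only needs a formula for the derivative and the induction hypothesis for that
  formula.\<close>

fun differentiable_times :: "nat \<Rightarrow> (real \<Rightarrow> real) \<Rightarrow> bool" where
  "differentiable_times 0 f \<longleftrightarrow> True"
| "differentiable_times (Suc k) f \<longleftrightarrow>
     (\<exists>f'. (\<forall>x. (f has_real_derivative f' x) (at x)) \<and> differentiable_times k f')"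

lemma differentiable_times_imp_differentiable_on:
  "differentiable_times (Suc k) f \<Longrightarrow> (deriv ^^ k) f differentiable_on UNIV"
proof (induction k arbitrary: f)
  case 0
  then show ?case
    by (auto simp: differentiable_on_def real_differentiable_def)
next
  case (Suc k)
  then obtain f' where f': "\<And>x. (f has_real_derivative f' x) (at x)" "differentiable_times (Suc k) f'"
    by auto
  have "deriv f = f'"
    using f'(1) by (auto intro!: DERIV_imp_deriv)
  then show ?case
    using Suc.IH[OF f'(2)] by (simp del: funpow.simps add: funpow_Suc_right)
qed

lemma differentiable_times_Suc_imp:
  "differentiable_times (Suc k) f \<Longrightarrow> differentiable_times k f"
  by (induction k arbitrary: f) (simp, metis differentiable_times.simps(2))

lemma differentiable_times_add:
  "differentiable_times k f \<Longrightarrow> differentiable_times k g \<Longrightarrow> differentiable_times k (\<lambda>x. f x + g x)"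
proof (induction k arbitrary: f g)
  case (Suc k)
  then obtain f' g' where
    "\<And>x. (f has_real_derivative f' x) (at x)" "differentiable_times k f'"
    "\<And>x. (g has_real_derivative g' x) (at x)" "differentiable_times k g'"
    by auto
  then show ?case
    using Suc.IH[of f' g'] by (auto intro!: exI[of _ "\<lambda>x. f' x + g' x"] derivative_intros)
qed simp

lemma differentiable_times_mult:
  "differentiable_times k f \<Longrightarrow> differentiable_times k g \<Longrightarrow> differentiable_times k (\<lambda>x. f x * g x)"
proof (induction k arbitrary: f g)
  case (Suc k)
  then obtain f' g' where
    "\<And>x. (f has_real_derivative f' x) (at x)" "differentiable_times k f'"
    "\<And>x. (g has_real_derivative g' x) (at x)" "differentiable_times k g'"
    by auto
  \<comment> \<open>The product rule pairs each derivative with an undifferentiated factor, so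
    \<open>f\<close> and \<open>g\<close> themselves are needed at order \<open>k\<close>.\<close>
  moreover have "differentiable_times k f" "differentiable_times k g"
    using Suc.prems differentiable_times_Suc_imp by blast+
  ultimately have "\<And>x. ((\<lambda>x. f x * g x) has_real_derivative f' x * g x + g' x * f x) (at x)"
      "differentiable_times k (\<lambda>x. f' x * g x + g' x * f x)"
    using Suc.IH by (auto intro!: derivative_intros differentiable_times_add)
  then show ?case
    by (auto intro!: exI[of _ "\<lambda>x. f' x * g x + g' x * f x"])
qed simp

text \<open>The factor \<open>c\<close> absorbs the \<open>m\<close> produced by the chain rule, so
  the shape is stable under differentiation and the induction closes.\<close>

lemma differentiable_times_affine:
  "differentiable_times k f \<Longrightarrow> differentiable_times k (\<lambda>x. c * f (m * x + q))"
proof (induction k arbitrary: f c)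
  case (Suc k)
  then obtain f' where f': "\<And>x. (f has_real_derivative f' x) (at x)" "differentiable_times k f'"
    by auto
  have "((\<lambda>x. f (m * x + q)) has_real_derivative f' (m * x + q) * m) (at x)" for x
    by (rule DERIV_chain2[where f = f and g = "\<lambda>x. m * x + q", OF f'(1)])
      (auto intro!: derivative_eq_intros)
  then have "((\<lambda>x. c * f (m * x + q)) has_real_derivative (c * m) * f' (m * x + q)) (at x)" for x
    by (rule DERIV_cong[OF DERIV_cmult]) simp
  then show ?case
    using Suc.IH[OF f'(2), of "c * m"]
    by (auto intro!: exI[of _ "\<lambda>x. (c * m) * f' (m * x + q)"])
qed simp

section \<open>A smooth bump supported in the unit interval\<close>

text \<open>The classical smooth function exp (- 1 / x), extended by zero. The polynomial factor in
  1 / x makes the family closed under differentiation.\<close>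

definition flat_exp :: "real poly \<Rightarrow> real \<Rightarrow> real" where
  "flat_exp P x = (if x > 0 then poly P (1 / x) * exp (- (1 / x)) else 0)"

text \<open>With y = 1 / x the right-hand limit is that of a polynomial divided by exp y at
  infinity; on the left the function is zero.\<close>

lemma flat_exp_tendsto_0: "(flat_exp P \<longlongrightarrow> 0) (at 0)"
proof -
  have "((\<lambda>y. \<Sum>i\<le>degree P. coeff P i * (y ^ i / exp y)) \<longlongrightarrow> (\<Sum>i\<le>degree P. coeff P i * 0)) at_top"
    by (intro tendsto_intros tendsto_power_div_exp_0)
  then have "((\<lambda>y. poly P y * exp (- y)) \<longlongrightarrow> 0) at_top"
    by (simp add: poly_altdef sum_distrib_right exp_minus divide_inverse mult.assoc)
  then have "((\<lambda>x. poly P (inverse x) * exp (- inverse x)) \<longlongrightarrow> 0) (at_right 0)"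
    by (rule filterlim_compose[OF _ filterlim_inverse_at_top_right])
  then have "(flat_exp P \<longlongrightarrow> 0) (at_right 0)"
    by (rule Lim_transform_eventually)
      (auto simp: flat_exp_def divide_inverse eventually_at intro!: exI[of _ 1])
  moreover have "(flat_exp P \<longlongrightarrow> 0) (at_left 0)"
    by (rule Lim_transform_eventually[OF tendsto_const])
      (auto simp: flat_exp_def eventually_at intro!: exI[of _ 1])
  ultimately show ?thesis
    by (rule filterlim_split_at_real[rotated])
qed

text \<open>The polynomial \<open>[:0, 0, 1:]\<close> is the factor 1 / x^2 from the derivative of 1
  / x. At 0 the difference quotient is again a member of the family, with \<open>P\<close>
  multiplied by its variable, so it tends to 0.\<close>

lemma flat_exp_has_derivative:
  "(flat_exp P has_real_derivative flat_exp ([:0, 0, 1:] * (P - pderiv P)) x) (at x)"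
proof -
  consider "x < 0" | "x = 0" | "x > 0" by linarith
  then show ?thesis
  proof cases
    case 1
    have "((\<lambda>x. 0) has_real_derivative 0) (at x)" by simp
    then show ?thesis
      by (rule has_field_derivative_transform_within_open[of _ _ _ "{..<0}", THEN DERIV_cong])
        (use 1 in \<open>auto simp: flat_exp_def\<close>)
  next
    case 2
    have quotient: "(flat_exp P (0 + h) - flat_exp P 0) / h = flat_exp ([:0, 1:] * P) h" for h
      by (auto simp: flat_exp_def)
    have zero: "flat_exp Q 0 = 0" for Q
      by (simp add: flat_exp_def)
    show ?thesis
      unfolding DERIV_def 2 quotient unfolding zero by (rule flat_exp_tendsto_0)
  next
    case 3
    have inv: "((\<lambda>x. 1 / x) has_real_derivative - (1 / x\<^sup>2)) (at x)"
      using 3 by (auto intro!: derivative_eq_intros simp: power2_eq_square)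
    have "((\<lambda>x. poly P (1 / x)) has_real_derivative poly (pderiv P) (1 / x) * - (1 / x\<^sup>2)) (at x)"
      by (rule DERIV_chain2[where f = "poly P" and g = "\<lambda>x. 1 / x", OF poly_DERIV inv])
    moreover have "((\<lambda>x. exp (- (1 / x))) has_real_derivative exp (- (1 / x)) * - (- (1 / x\<^sup>2))) (at x)"
      by (rule DERIV_chain2[where f = exp and g = "\<lambda>x. - (1 / x)", OF DERIV_exp DERIV_minus[OF inv]])
    ultimately have "((\<lambda>x. poly P (1 / x) * exp (- (1 / x))) has_real_derivative
        poly ([:0, 0, 1:] * (P - pderiv P)) (1 / x) * exp (- (1 / x))) (at x)"
      by (rule DERIV_cong[OF DERIV_mult]) (simp add: power2_eq_square algebra_simps)
    then show ?thesis
      by (rule has_field_derivative_transform_within_open[of _ _ _ "{0<..}", THEN DERIV_cong])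
        (use 3 in \<open>auto simp: flat_exp_def\<close>)
  qed
qed

lemma differentiable_times_flat_exp: "differentiable_times k (flat_exp P)"
  by (induction k arbitrary: P) (auto intro: flat_exp_has_derivative)

text \<open>The first factor vanishes for x \<le> 0, the second for x \<ge> 1; the index
  \<open>1\<close> is the constant polynomial.\<close>

definition bump :: "real \<Rightarrow> real" where
  "bump x = flat_exp 1 x * flat_exp 1 (1 - x)"

lemma bump_nonneg: "bump x \<ge> 0"
  and bump_pos: "0 < x \<Longrightarrow> x < 1 \<Longrightarrow> bump x > 0"
  and bump_eq_0: "x \<le> 0 \<or> x \<ge> 1 \<Longrightarrow> bump x = 0"
  by (auto simp: bump_def flat_exp_def)

lemma differentiable_times_bump: "differentiable_times k bump"
proof -
  have "differentiable_times k (\<lambda>x. flat_exp 1 x * (1 * flat_exp 1 (- 1 * x + 1)))"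
    by (intro differentiable_times_mult differentiable_times_affine differentiable_times_flat_exp)
  then show ?thesis
    by (simp add: bump_def[abs_def])
qed

lemma continuous_on_bump: "continuous_on S bump"
proof -
  have "\<exists>f'. \<forall>x. (bump has_real_derivative f' x) (at x)"
    using differentiable_times_bump[of "Suc 0"] by simp
  then show ?thesis
    by (metis DERIV_isCont continuous_at_imp_continuous_on)
qed

text \<open>Since the primitive is constant on either side of the unit interval, the difference of
  two translates has compact support. Test functions are built in this way.\<close>

lemma ex_bump_antiderivative:
  obtains \<Phi> where "\<And>x. (\<Phi> has_real_derivative bump x) (at x)" "\<And>k. differentiable_times k \<Phi>"
    "\<And>x. x \<le> 0 \<Longrightarrow> \<Phi> x = \<Phi> 0" "\<And>x. x \<ge> 1 \<Longrightarrow> \<Phi> x = \<Phi> 1"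
proof -
  have "\<exists>\<Phi>. \<forall>x. - \<infinity> < ereal x \<longrightarrow> ereal x < \<infinity> \<longrightarrow> (\<Phi> has_vector_derivative bump x) (at x)"
    by (rule einterval_antiderivative) (use continuous_on_bump[of UNIV] in \<open>auto simp: continuous_on_eq_continuous_at\<close>)
  then obtain \<Phi> where *: "\<And>x. (\<Phi> has_real_derivative bump x) (at x)"
    by (auto simp: has_real_derivative_iff_has_vector_derivative)
  have "differentiable_times k \<Phi>" for k
    using * differentiable_times_bump by (cases k) auto
  moreover have "\<exists>c. \<forall>x\<in>S. \<Phi> x = c" if "convex S" "\<And>x. x \<in> S \<Longrightarrow> x \<le> 0 \<or> x \<ge> 1" for S
  proof (rule has_field_derivative_zero_constant[OF that(1)])
    fix x assume "x \<in> S"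
    then show "(\<Phi> has_real_derivative 0) (at x within S)"
      using *[of x] bump_eq_0[OF that(2)] by (auto intro: has_field_derivative_at_within)
  qed
  from this[of "{..0}"] this[of "{1..}"]
  have "\<And>x. x \<le> 0 \<Longrightarrow> \<Phi> x = \<Phi> 0" "\<And>x. x \<ge> 1 \<Longrightarrow> \<Phi> x = \<Phi> 1"
    by auto
  ultimately show ?thesis
    using * that by blast
qed

section \<open>The fundamental theorem of calculus for weak derivatives\<close>

text \<open>Passes from the Lebesgue integral in the weak equation to the gauge integral on a
  compact interval, where integration by parts is carried out.\<close>

lemma set_lebesgue_integral_eq_integral_supported:
  fixes k :: "real \<Rightarrow> real"
  assumes "0 < a" "continuous_on {a..c} k" "\<And>t. t \<notin> {a..c} \<Longrightarrow> k t = 0"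
  shows "(LBINT t:{0<..}. k t) = integral {a..c} k"
proof -
  have "(LBINT t:{0<..}. k t) = (LBINT t:{a..c}. k t)"
    unfolding set_lebesgue_integral_def
    by (intro Bochner_Integration.integral_cong) (use assms in \<open>auto simp: indicator_def\<close>)
  also have "\<dots> = integral {a..c} k"
    by (rule set_borel_integral_eq_integral(2)) (use assms in \<open>auto intro: borel_integrable_atLeastAtMost'\<close>)
  finally show ?thesis .
qed

text \<open>
  If the difference \<open>G\<close> of \<open>g\<close> and a primitive of \<open>h\<close> took different values at \<open>a\<close> and \<open>b\<close>, testing against the
  primitive of (bump near \<open>a\<close>) - (bump near \<open>b\<close>) would give a nonzero integral. A constant \<open>m\<close> between
  the two values may be subtracted from \<open>G\<close> since the two bumps have equal mass.
\<close>

lemma distributional_derivative_primitive_const: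
  assumes gh: "has_distributional_derivative g h"
    and g: "continuous_on {0..} g" and h: "continuous_on {0..} h" and ab: "0 < a" "a < b"
  shows "g a - integral {0..a} h = g b - integral {0..b} h"
proof (rule ccontr)
  define H where "H t = integral {0..t} h" for t
  define G where "G t = g t - H t" for t
  assume "\<not> ?thesis"
  then have neq: "G a \<noteq> G b" by (simp add: G_def H_def)
  define m where "m = (G a + G b) / 2"
  \<comment> \<open>The sign treats both orders of \<open>G a\<close> and \<open>G b\<close> at
    once: \<sigma> (G - m) is positive at \<open>a\<close> and negative at \<open>b\<close>.\<close>
  define \<sigma> where "\<sigma> = sgn (G a - G b)"
  have contH: "continuous_on {0..c} H" for c
    unfolding H_def
    by (rule indefinite_integral_continuous_1)
      (auto intro!: integrable_continuous_interval continuous_on_subset[OF h])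
  have contG: "continuous_on {0..c} G" for c
    unfolding G_def by (intro continuous_intros contH continuous_on_subset[OF g]) auto
  have sa: "\<sigma> * (G a - m) > 0" and sb: "\<sigma> * (G b - m) < 0"
    using neq by (auto simp: \<sigma>_def m_def sgn_if field_simps)
  have cont: "continuous_on {0..b+1} (\<lambda>t. \<sigma> * (G t - m))"
    by (intro continuous_intros contG)
  have "\<exists>\<delta>>0. \<forall>t\<in>{0..b+1}. dist t a < \<delta> \<longrightarrow> dist (\<sigma> * (G t - m)) (\<sigma> * (G a - m)) < \<sigma> * (G a - m)"
    using cont ab sa unfolding continuous_on_iff by auto
  then obtain \<delta>1 where \<delta>1: "\<delta>1 > 0"
    "\<And>t. t \<in> {0..b+1} \<Longrightarrow> dist t a < \<delta>1 \<Longrightarrow> \<sigma> * (G t - m) > 0"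
    by (force simp: dist_real_def abs_less_iff)
  have "\<exists>\<delta>>0. \<forall>t\<in>{0..b+1}. dist t b < \<delta> \<longrightarrow> dist (\<sigma> * (G t - m)) (\<sigma> * (G b - m)) < - (\<sigma> * (G b - m))"
    using cont[unfolded continuous_on_iff, rule_format, of b "- (\<sigma> * (G b - m))"] ab sb by auto
  then obtain \<delta>2 where \<delta>2: "\<delta>2 > 0"
    "\<And>t. t \<in> {0..b+1} \<Longrightarrow> dist t b < \<delta>2 \<Longrightarrow> \<sigma> * (G t - m) < 0"
    by (force simp: dist_real_def abs_less_iff)
  \<comment> \<open>The bumps will live on (a, a + \<delta>) and (b, b + \<delta>). The bounds keep
    them disjoint, inside the regions of constant sign and inside \<open>{0..b+1}\<close>.\<close>
  define \<delta> where "\<delta> = Min {\<delta>1 / 2, \<delta>2 / 2, 1, (b - a) / 2}"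
  have \<delta>: "\<delta> > 0" "\<delta> < \<delta>1" "\<delta> < \<delta>2" "\<delta> \<le> 1" "\<delta> < b - a"
    using \<delta>1 \<delta>2 ab by (auto simp: \<delta>_def min_def)
  define c where "c = b + \<delta>"
  obtain \<Phi> where \<Phi>: "\<And>x. (\<Phi> has_real_derivative bump x) (at x)" "\<And>k. differentiable_times k \<Phi>"
    "\<And>x. x \<le> 0 \<Longrightarrow> \<Phi> x = \<Phi> 0" "\<And>x. x \<ge> 1 \<Longrightarrow> \<Phi> x = \<Phi> 1"
    using ex_bump_antiderivative by blast
  \<comment> \<open>The two primitives cancel to the left of \<open>a\<close> and to the right of b
    + \<delta>, so \<psi> has compact support.\<close>
  define \<psi> where "\<psi> t = \<Phi> ((t - a) / \<delta>) - \<Phi> ((t - b) / \<delta>)" for t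
  define \<psi>' where "\<psi>' t = (bump ((t - a) / \<delta>) - bump ((t - b) / \<delta>)) / \<delta>" for t
  have \<psi>_deriv: "(\<psi> has_real_derivative \<psi>' t) (at t)" for t
  proof -
    have "((\<lambda>t. \<Phi> ((t - q) / \<delta>)) has_real_derivative bump ((t - q) / \<delta>) * (1 / \<delta>)) (at t)" for q
      by (rule DERIV_chain2[where f = \<Phi> and g = "\<lambda>t. (t - q) / \<delta>", OF \<Phi>(1)])
        (use \<delta> in \<open>auto intro!: derivative_eq_intros\<close>)
    from DERIV_diff[OF this[of a] this[of b]] show ?thesis
      by (simp add: \<psi>_def[abs_def] \<psi>'_def diff_divide_distrib)
  qed
  have deriv_\<psi>: "deriv \<psi> = \<psi>'"
    using \<psi>_deriv by (auto intro!: DERIV_imp_deriv)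
  have \<psi>_0: "\<psi> t = 0" if "t \<notin> {a<..<c}" for t
  proof (cases "t \<le> a")
    case True
    then show ?thesis
      using \<Phi>(3)[of "(t - a) / \<delta>"] \<Phi>(3)[of "(t - b) / \<delta>"] \<delta> ab
      by (simp add: \<psi>_def divide_nonpos_pos)
  next
    case False
    then show ?thesis
      using \<Phi>(4)[of "(t - a) / \<delta>"] \<Phi>(4)[of "(t - b) / \<delta>"] \<delta> ab that
      by (simp add: \<psi>_def c_def)
  qed
  have \<psi>'_0: "\<psi>' t = 0" if "t \<notin> {a<..<c}" for t
    using that \<delta> ab bump_eq_0[of "(t - a) / \<delta>"] bump_eq_0[of "(t - b) / \<delta>"]
    by (cases "t \<le> a") (auto simp: \<psi>'_def c_def divide_nonpos_pos)
  have supp: "{t. \<psi> t \<noteq> 0} \<subseteq> {a..c}"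
  proof
    fix t assume "t \<in> {t. \<psi> t \<noteq> 0}"
    then show "t \<in> {a..c}"
      using \<psi>_0[of t] by (cases "t \<in> {a<..<c}") auto
  qed
  have closure_supp: "closure {t. \<psi> t \<noteq> 0} \<subseteq> {a..c}"
    by (rule closure_minimal[OF supp]) simp
  have smooth: "differentiable_times k \<psi>" for k
    using differentiable_times_add[OF
        differentiable_times_affine[OF \<Phi>(2), of k 1 "1 / \<delta>" "- a / \<delta>"]
        differentiable_times_affine[OF \<Phi>(2), of k "-1" "1 / \<delta>" "- b / \<delta>"]]
    by (simp add: \<psi>_def[abs_def] diff_divide_distrib)
  have "bounded {t. \<psi> t \<noteq> 0}"
    by (rule bounded_subset[OF bounded_closed_interval supp])
  moreover have "closure {t. \<psi> t \<noteq> 0} \<subseteq> {0<..}"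
    using closure_supp ab by force
  ultimately have test: "test_function \<psi>"
    unfolding test_function_def compact_closure
    using smooth differentiable_times_imp_differentiable_on by blast
  have cont\<psi>: "continuous_on S \<psi>" for S
    using \<psi>_deriv DERIV_isCont continuous_at_imp_continuous_on by blast
  have cont\<psi>': "continuous_on S \<psi>'" for S
    unfolding \<psi>'_def
    by (intro continuous_intros continuous_on_compose2[OF continuous_on_bump[of UNIV]]) (use \<delta> in auto)
  have sub: "{a..c} \<subseteq> {0..c}" "{a..c} \<subseteq> {0..}" using ab by auto
  note conts = continuous_on_subset[OF g sub(2)] continuous_on_subset[OF h sub(2)]
    continuous_on_subset[OF contH sub(1)] cont\<psi> cont\<psi>'
  have dist_eq: "- integral {a..c} (\<lambda>t. g t * \<psi>' t) = integral {a..c} (\<lambda>t. h t * \<psi> t)"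
  proof -
    have "- (LBINT t:{0<..}. g t * \<psi>' t) = (LBINT t:{0<..}. h t * \<psi> t)"
      using gh test deriv_\<psi> unfolding has_distributional_derivative_def by metis
    moreover have "(LBINT t:{0<..}. g t * \<psi>' t) = integral {a..c} (\<lambda>t. g t * \<psi>' t)"
      by (rule set_lebesgue_integral_eq_integral_supported)
        (use ab \<psi>'_0 in \<open>auto intro!: continuous_intros conts\<close>)
    moreover have "(LBINT t:{0<..}. h t * \<psi> t) = integral {a..c} (\<lambda>t. h t * \<psi> t)"
      by (rule set_lebesgue_integral_eq_integral_supported)
        (use ab \<psi>_0 in \<open>auto intro!: continuous_intros conts\<close>)
    ultimately show ?thesis by simp
  qed
  \<comment> \<open>Integration by parts: the boundary terms vanish with \<psi>, so the integral of
    h \<psi> is minus that of H \<psi>'.\<close>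
  have "((\<lambda>t. H t * \<psi>' t + h t * \<psi> t) has_integral H c * \<psi> c - H a * \<psi> a) {a..c}"
  proof (rule fundamental_theorem_of_calculus)
    show "a \<le> c" using ab \<delta> by (simp add: c_def)
    fix t assume t: "t \<in> {a..c}"
    have "(H has_vector_derivative h t) (at t within {0..c})"
      unfolding H_def by (rule integral_has_vector_derivative)
        (use t ab in \<open>auto intro: continuous_on_subset[OF h]\<close>)
    then have "(H has_real_derivative h t) (at t within {a..c})"
      using sub by (auto simp: has_real_derivative_iff_has_vector_derivative
          intro: has_vector_derivative_within_subset)
    from DERIV_mult'[OF this \<psi>_deriv[THEN has_field_derivative_at_within]]
    show "((\<lambda>t. H t * \<psi> t) has_vector_derivative H t * \<psi>' t + h t * \<psi> t) (at t within {a..c})"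
      by (simp add: has_real_derivative_iff_has_vector_derivative)
  qed
  then have parts: "((\<lambda>t. H t * \<psi>' t + h t * \<psi> t) has_integral 0) {a..c}"
    using \<psi>_0[of a] \<psi>_0[of c] by simp
  have "(\<psi>' has_integral \<psi> c - \<psi> a) {a..c}"
    by (rule fundamental_theorem_of_calculus)
      (use ab \<delta> \<psi>_deriv in \<open>auto simp: c_def has_real_derivative_iff_has_vector_derivative[symmetric] intro: has_field_derivative_at_within\<close>)
  then have int_\<psi>': "(\<psi>' has_integral 0) {a..c}"
    using \<psi>_0[of a] \<psi>_0[of c] by simp
  define I where "I = integral {a..c} (\<lambda>t. g t * \<psi>' t)"
  have "((\<lambda>t. g t * \<psi>' t) has_integral I) {a..c}"
    unfolding I_def
    by (intro integrable_integral integrable_continuous_interval continuous_intros conts)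
  moreover have "((\<lambda>t. h t * \<psi> t) has_integral - I) {a..c}"
    unfolding I_def dist_eq
    by (intro integrable_integral integrable_continuous_interval continuous_intros conts)
  \<comment> \<open>The weak equation makes \<open>I\<close> and \<open>- I\<close> cancel, and the
    other terms integrate to zero. Regrouped, the integrand is \<sigma> (G - m) \<psi>'.\<close>
  ultimately have "((\<lambda>t. \<sigma> * (g t * \<psi>' t + h t * \<psi> t - (H t * \<psi>' t + h t * \<psi> t) - m * \<psi>' t))
      has_integral \<sigma> * (I + - I - 0 - m * 0)) {a..c}"
    by (intro has_integral_mult_right has_integral_diff has_integral_add parts int_\<psi>')
  moreover have "(\<lambda>t. \<sigma> * (g t * \<psi>' t + h t * \<psi> t - (H t * \<psi>' t + h t * \<psi> t) - m * \<psi>' t))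
      = (\<lambda>t. \<sigma> * (G t - m) * \<psi>' t)"
    by (auto simp: G_def algebra_simps)
  ultimately have zero: "integral {a..c} (\<lambda>t. \<sigma> * (G t - m) * \<psi>' t) = 0"
    by (simp add: integral_unique)
  \<comment> \<open>On the bump at \<open>a\<close> both factors are nonnegative, on the bump at
    \<open>b\<close> both are nonpositive, and elsewhere \<psi>' vanishes.\<close>
  have nonneg: "\<sigma> * (G t - m) * \<psi>' t \<ge> 0" if t: "t \<in> {a..c}" for t
  proof -
    consider "t \<le> a + \<delta>" | "a + \<delta> < t" "t < b" | "b \<le> t" by linarith
    then show ?thesis
    proof cases
      case 1
      then have "bump ((t - b) / \<delta>) = 0" using \<delta> by (intro bump_eq_0) (auto simp: divide_nonpos_pos)
      moreover have "\<sigma> * (G t - m) > 0" using 1 t \<delta> ab by (intro \<delta>1) (auto simp: dist_real_def)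
      ultimately show ?thesis using bump_nonneg \<delta> by (simp add: \<psi>'_def)
    next
      case 2
      then show ?thesis using \<delta> bump_eq_0[of "(t - a) / \<delta>"] bump_eq_0[of "(t - b) / \<delta>"]
        by (simp add: \<psi>'_def divide_nonpos_pos)
    next
      case 3
      then have "bump ((t - a) / \<delta>) = 0" using \<delta> by (intro bump_eq_0) auto
      moreover have "\<sigma> * (G t - m) < 0" using 3 t \<delta> ab by (intro \<delta>2) (auto simp: dist_real_def c_def)
      moreover have "bump ((t - b) / \<delta>) / \<delta> \<ge> 0" using bump_nonneg \<delta> by simp
      ultimately show ?thesis by (intro mult_nonpos_nonpos) (auto simp: \<psi>'_def)
    qed
  qed
  have "continuous_on {a..c} (\<lambda>t. \<sigma> * (G t - m) * \<psi>' t)"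
    by (intro continuous_intros conts continuous_on_subset[OF contG sub(1)])
  \<comment> \<open>A continuous nonnegative function with zero integral vanishes identically. The
    midpoint of the first bump contradicts this.\<close>
  then have prod: "\<sigma> * (G (a + \<delta> / 2) - m) * \<psi>' (a + \<delta> / 2) = 0"
    using zero nonneg ab \<delta> by (subst (asm) integral_eq_0_iff) (auto simp: c_def)
  have "\<sigma> * (G (a + \<delta> / 2) - m) > 0"
    using \<delta> ab by (intro \<delta>1) (auto simp: dist_real_def)
  moreover have "bump ((a + \<delta> / 2 - b) / \<delta>) = 0"
    using \<delta> by (intro bump_eq_0 disjI1 divide_nonpos_pos) auto
  then have "\<psi>' (a + \<delta> / 2) > 0"
    using \<delta> bump_pos[of "1/2"] by (simp add: \<psi>'_def)
  ultimately have "\<sigma> * (G (a + \<delta> / 2) - m) * \<psi>' (a + \<delta> / 2) > 0"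
    by (rule mult_pos_pos)
  with prod show False by linarith
qed

text \<open>Test functions only see positive times, so g minus the primitive of h is constant on
  \<open>{0<..T}\<close>; continuity extends this to time 0.\<close>

lemma distributional_derivative_FTC:
  assumes gh: "has_distributional_derivative g h"
    and g: "continuous_on {0..} g" and h: "continuous_on {0..} h" and T: "T > 0"
  shows "integral {0..T} h = g T - g 0"
proof -
  define G where "G t = g t - integral {0..t} h" for t
  have "continuous_on {0..T} (\<lambda>t. integral {0..t} h)"
    by (intro indefinite_integral_continuous_1 integrable_continuous_interval continuous_on_subset[OF h]) auto
  then have cont: "continuous_on {0..T} G"
    unfolding G_def by (intro continuous_intros continuous_on_subset[OF g]) auto
  have "G 0 = G T"
  proof (rule continuous_constant_on_closure[where S = "{0<..T}" and f = G and a = "G T" and x = 0])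
    show "continuous_on (closure {0<..T}) G"
      using cont T by simp
    show "G t = G T" if "t \<in> {0<..T}" for t
      using distributional_derivative_primitive_const[OF gh g h, of t T] that
      unfolding G_def by (cases "t = T") auto
    show "0 \<in> closure {0<..T}"
      using T by simp
  qed
  then show ?thesis by (simp add: G_def)
qed

section \<open>Sequences with recurrent growth\<close>

text \<open>If \<open>J\<close> were unbounded, the two estimates would give a \<le> K along
  \<open>J\<close>, hence everywhere by monotonicity. Then \<open>a\<close> converges and its
  two-step increments tend to 0, while on \<open>J\<close> they are at least (a R0)^2 / K beyond
  \<open>R0\<close>.\<close>

lemma finite_of_recurrent_growth:
  fixes a :: "nat \<Rightarrow> real"
  assumes a: "mono a" "a R0 > 0" and K: "K > 0"
    and J: "\<And>R. R \<in> J \<Longrightarrow> (a R)\<^sup>2 \<le> K * (a (R + 1) - a (R - 1))"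
    and K2: "\<And>R. R \<in> J \<Longrightarrow> a (R + 1) - a (R - 1) \<le> K"
  shows "finite J"
proof (rule ccontr)
  assume "infinite J"
  then have inf: "\<exists>R\<in>J. R \<ge> m" for m
    by (meson infinite_nat_iff_unbounded_le)
  have "a m \<le> K" for m
  proof -
    obtain R where R: "R \<in> J" "R \<ge> m" using inf by blast
    have "(a R)\<^sup>2 \<le> K * K"
      by (rule order_trans[OF J[OF R(1)]]) (use K K2[OF R(1)] in simp)
    then have "a R \<le> K"
      using K by (metis less_imp_le power2_eq_square power2_le_imp_le)
    then show ?thesis
      using monoD[OF a(1) R(2)] by simp
  qed
  then obtain l where l: "a \<longlonglongrightarrow> l"
    using a(1) by (meson incseq_convergent)
  then have "(\<lambda>n. a (n + 2) - a n) \<longlonglongrightarrow> l - l"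
    by (intro tendsto_intros LIMSEQ_ignore_initial_segment)
  moreover have "(a R0)\<^sup>2 / K > 0" using a(2) K by simp
  ultimately have "eventually (\<lambda>n. a (n + 2) - a n < (a R0)\<^sup>2 / K) sequentially"
    by (intro order_tendstoD) auto
  then obtain M where M: "\<And>n. n \<ge> M \<Longrightarrow> a (n + 2) - a n < (a R0)\<^sup>2 / K"
    by (auto simp: eventually_sequentially)
  \<comment> \<open>The summand 1 leaves R - 1 \<ge> M, the index at which the two-step increment
    starts.\<close>
  obtain R where R: "R \<in> J" "R \<ge> R0 + M + 1" using inf by blast
  have "a (R + 1) - a (R - 1) < (a R0)\<^sup>2 / K"
    using M[of "R - 1"] R by (simp add: Suc_diff_Suc numeral_2_eq_2)
  then have "K * (a (R + 1) - a (R - 1)) < (a R0)\<^sup>2"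
    using K by (simp add: field_simps)
  also have "\<dots> \<le> (a R)\<^sup>2"
    using a R by (intro power_mono monoD[OF a(1)]) auto
  finally show False using J[OF R(1)] by simp
qed

text \<open>
  Radii with \<open>a (R + 1) \<le> 2 a R\<close> are controlled by the telescoping sum of \<open>1 / a (R - 1) - 1 / a (R + 1)\<close>,
  the others, at which \<open>a\<close> jumps by a factor, by that of \<open>1 / sqrt (a R) - 1 / sqrt (a (R + 1))\<close>.
\<close>

lemma summable_on_inverse_of_recurrent_growth:
  fixes a :: "nat \<Rightarrow> real"
  assumes a: "mono a" "a R0 > 0" and K: "K > 0"
    and J: "\<And>R. R \<in> J \<Longrightarrow> R \<ge> 1 \<and> (a R)\<^sup>2 \<le> K * real R * (a (R + 1) - a (R - 1))"
    and K2: "\<And>R. R \<in> J \<Longrightarrow> a (R + 1) \<le> K * (real R)\<^sup>2"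
  shows "(\<lambda>r. 1 / real r) summable_on J"
proof -
  define L where "L = 4 * sqrt K"
  \<comment> \<open>The two-step difference of reciprocals is split into two one-step differences,
    each of which telescopes.\<close>
  define s where "s R = 2 * K * ((1 / a R - 1 / a (R + 1)) + (1 / a (R - 1) - 1 / a R))
      + L * (1 / sqrt (a R) - 1 / sqrt (a (R + 1)))" for R
  obtain l where l: "(\<lambda>n. inverse (a n)) \<longlonglongrightarrow> l"
  proof -
    \<comment> \<open>Reciprocals are monotone only where \<open>a\<close> is positive, hence the
      shift by \<open>R0\<close>.\<close>
    have "decseq (\<lambda>n. inverse (a (n + R0)))"
      using a by (auto simp: decseq_def intro!: le_imp_inverse_le monoD[OF a(1)] less_le_trans[OF a(2)])
    moreover have "inverse (a (n + R0)) \<ge> 0" for n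
      using a monoD[OF a(1), of R0 "n + R0"] by simp
    ultimately obtain l where "(\<lambda>n. inverse (a (n + R0))) \<longlonglongrightarrow> l"
      using decseq_convergent by blast
    then show ?thesis using that LIMSEQ_offset[of "\<lambda>n. inverse (a n)" R0] by blast
  qed
  have l': "(\<lambda>n. 1 / a n) \<longlonglongrightarrow> l" using l by (simp add: divide_inverse)
  have "(\<lambda>n. sqrt (inverse (a n))) \<longlonglongrightarrow> sqrt l" using l by (intro tendsto_intros)
  then have r: "(\<lambda>n. 1 / sqrt (a n)) \<longlonglongrightarrow> sqrt l" by (simp add: divide_inverse real_sqrt_inverse)
  have t1: "summable (\<lambda>n. 1 / a n - 1 / a (n + 1))"
    using telescope_summable'[OF l'] by simp
  \<comment> \<open>At n = 0 truncated subtraction gives a zero term; from n = 1 on this is the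
    previous series shifted.\<close>
  then have t2: "summable (\<lambda>n. 1 / a (n - 1) - 1 / a n)"
    by (subst summable_Suc_iff[symmetric]) simp
  have t3: "summable (\<lambda>n. 1 / sqrt (a n) - 1 / sqrt (a (n + 1)))"
    using telescope_summable'[OF r] by simp
  have s: "summable s"
    unfolding s_def by (intro summable_add summable_mult t1 t2 t3)
  \<comment> \<open>From R0 + 1 on, a (R - 1) is positive and may be inverted.\<close>
  have bound: "norm (if R \<in> J then 1 / real R else 0) \<le> s R" if R: "R \<ge> R0 + 1" for R
  proof -
    define x y z where "x = a (R - 1)" and "y = a R" and "z = a (R + 1)"
    have R0: "R0 \<le> R - 1" using R by simp
    have xyz: "0 < x" "x \<le> y" "y \<le> z"
      using monoD[OF a(1), of R0 "R - 1", OF R0] a(2) by (auto simp: x_def y_def z_def intro: monoD[OF a(1)])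
    have s_eq: "s R = 2 * K * (1 / x - 1 / z) + L * (1 / sqrt y - 1 / sqrt z)"
      by (simp add: s_def x_def y_def z_def)
    have p1: "1 / x - 1 / z \<ge> 0" using xyz by (simp add: frac_le)
    have p2: "1 / sqrt y - 1 / sqrt z \<ge> 0" using xyz by (simp add: frac_le)
    have L: "L > 0" using K by (simp add: L_def)
    show ?thesis
    proof (cases "R \<in> J")
      case False
      then show ?thesis unfolding s_eq using p1 p2 L K by simp
    next
      case True
      have Rpos: "real R > 0" using R by simp
      show ?thesis
      proof (cases "z \<le> 2 * y")
        case True
        \<comment> \<open>Then x z \<le> 2 y^2 \<le> 2 K R (z - x), and division by R x z gives the
          telescoping bound.\<close>
        have "x * z \<le> y * (2 * y)" using xyz True by (intro mult_mono) auto
        also have "\<dots> \<le> 2 * (K * real R * (z - x))"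
          using J[OF \<open>R \<in> J\<close>] by (simp add: x_def y_def z_def power2_eq_square)
        finally have "1 / real R \<le> 2 * K * (1 / x - 1 / z)"
          using xyz Rpos by (simp add: field_simps)
        then show ?thesis unfolding s_eq using p2 L Rpos \<open>R \<in> J\<close> by (simp add: add_increasing2)
      next
        case False
        \<comment> \<open>In the case of a jump, the quadratic growth bound turns 1 / R into a
          multiple of 1 / sqrt z.\<close>
        have "sqrt z \<le> sqrt K * R"
          using real_sqrt_le_mono[OF K2[OF \<open>R \<in> J\<close>]] by (simp add: z_def real_sqrt_mult)
        then have "1 / real R \<le> sqrt K / sqrt z"
          using xyz Rpos by (simp add: field_simps)
        also have "\<dots> \<le> L * (1 / sqrt y - 1 / sqrt z)"
        proof -
          \<comment> \<open>Here 25 / 16 \<le> 2. The ratio 5 / 4 is what yields the factor 4 in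
            \<open>L\<close>.\<close>
          have "(5 / 4 * sqrt y)\<^sup>2 \<le> (sqrt z)\<^sup>2" using False xyz by (simp add: power_mult_distrib power2_eq_square)
          then have "5 / 4 * sqrt y \<le> sqrt z" by (rule power2_le_imp_le) (use xyz in simp)
          then have "1 / sqrt z * (5 / 4) \<le> 1 / sqrt y" using xyz by (simp add: field_simps)
          then have "1 / sqrt z \<le> 4 * (1 / sqrt y - 1 / sqrt z)" by simp
          then show ?thesis using K mult_left_mono[of "1 / sqrt z" "4 * (1 / sqrt y - 1 / sqrt z)" "sqrt K"]
            by (simp add: L_def algebra_simps)
        qed
        finally show ?thesis unfolding s_eq using p1 K Rpos \<open>R \<in> J\<close> by (simp add: add_increasing)
      qed
    qed
  qed
  have "summable (\<lambda>R. if R \<in> J then 1 / real R else 0)"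
    by (rule summable_comparison_test_ev[OF _ s])
      (unfold eventually_sequentially, use bound in blast)
  moreover have "(\<lambda>R. norm (if R \<in> J then 1 / real R else 0)) = (\<lambda>R. if R \<in> J then 1 / real R else 0)"
    by auto
  ultimately have "summable (\<lambda>R. norm (if R \<in> J then 1 / real R else 0))"
    by metis
  then have "(\<lambda>R. if R \<in> J then 1 / real R else 0) summable_on UNIV"
    by (rule norm_summable_imp_summable_on)
  then show ?thesis
    by (rule summable_on_cong_neutral[THEN iffD1, rotated -1]) auto
qed

section \<open>Lattice cubes and shells\<close>

lemma card_lattice_cube: "card (lattice_cube R :: (int ^ 'n) set) = (2 * R) ^ CARD('n)"
proof -
  have "bij_betw vec_nth (lattice_cube R :: (int ^ 'n) set) (UNIV \<rightarrow>\<^sub>E {- int R + 1..int R})"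
    by (rule bij_betwI[where g = vec_lambda]) (auto simp: lattice_cube_def)
  then have "card (lattice_cube R :: (int ^ 'n) set) = card ((UNIV :: 'n set) \<rightarrow>\<^sub>E {- int R + 1..int R})"
    by (rule bij_betw_same_card)
  also have "\<dots> = (2 * R) ^ CARD('n)"
    by (subst card_PiE) (auto simp: nat_mult_distrib power_mult_distrib)
  finally show ?thesis .
qed

lemma lattice_cube_mono:
  assumes "R \<le> S"
  shows "lattice_cube R \<subseteq> lattice_cube S"
proof
  fix \<alpha> :: "int ^ 'n" assume "\<alpha> \<in> lattice_cube R"
  then have "- int R + 1 \<le> \<alpha> $ j" "\<alpha> $ j \<le> int R" for j
    by (auto simp: lattice_cube_def)
  moreover have "int R \<le> int S" using assms by simp
  ultimately show "\<alpha> \<in> lattice_cube S"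
    unfolding lattice_cube_def by (smt (verit) mem_Collect_eq)
qed

text \<open>Two layers thick, to hold both kinds of boundary sites of the backward difference: those
  of the cube with a coordinate \<open>R\<close>, and those just outside it with a coordinate
  \<open>- R\<close>.\<close>

definition lattice_shell :: "nat \<Rightarrow> (int ^ 'n) set" where
  "lattice_shell R = lattice_cube (R + 1) - lattice_cube (R - 1)"

lemma finite_lattice_shell: "finite (lattice_shell R :: (int ^ 'n) set)"
  by (simp add: lattice_shell_def finite_lattice_cube)

lemma sum_lattice_shell:
  "sum g (lattice_shell R) = sum g (lattice_cube (R + 1)) - (sum g (lattice_cube (R - 1)) :: real)"
  unfolding lattice_shell_def
  by (intro sum_diff finite_lattice_cube lattice_cube_mono) simp

text \<open>A discrete divergence theorem. In direction \<open>j\<close> the sums over the cube and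
  its translate cancel on the overlap, and the rest lies in the shell. Each direction contributes at
  most one shell sum.\<close>

lemma abs_sum_lattice_div_le:
  fixes v :: "int ^ 'n \<Rightarrow> real ^ 'n"
  assumes R: "R \<ge> 1"
  shows "\<bar>\<Sum>\<alpha>\<in>lattice_cube R. lattice_div v \<alpha>\<bar> \<le> CARD('n) * (\<Sum>\<alpha>\<in>lattice_shell R. norm (v \<alpha>))"
proof -
  let ?C = "lattice_cube R :: (int ^ 'n) set"
  have one: "\<bar>\<Sum>\<alpha>\<in>?C. v \<alpha> $ j - v (\<alpha> - axis j 1) $ j\<bar> \<le> (\<Sum>\<alpha>\<in>lattice_shell R. norm (v \<alpha>))" for j
  proof -
    define C' where "C' = (\<lambda>\<alpha>. \<alpha> - axis j 1) ` ?C"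
    have fin: "finite ?C" "finite C'" by (auto simp: C'_def finite_lattice_cube)
    have "(\<Sum>\<alpha>\<in>?C. v (\<alpha> - axis j 1) $ j) = (\<Sum>\<alpha>\<in>C'. v \<alpha> $ j)"
      unfolding C'_def by (subst sum.reindex) (auto simp: inj_on_def)
    then have "(\<Sum>\<alpha>\<in>?C. v \<alpha> $ j - v (\<alpha> - axis j 1) $ j)
        = (\<Sum>\<alpha>\<in>?C. v \<alpha> $ j) - (\<Sum>\<alpha>\<in>C'. v \<alpha> $ j)"
      by (simp add: sum_subtractf)
    also have "\<dots> = (\<Sum>\<alpha>\<in>?C - C'. v \<alpha> $ j) - (\<Sum>\<alpha>\<in>C' - ?C. v \<alpha> $ j)"
      using sum.Int_Diff[OF fin(1), of "\<lambda>\<alpha>. v \<alpha> $ j" C'] sum.Int_Diff[OF fin(2), of "\<lambda>\<alpha>. v \<alpha> $ j" ?C]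
      by (simp add: Int_commute)
    also have "\<bar>\<dots>\<bar> \<le> (\<Sum>\<alpha>\<in>?C - C'. norm (v \<alpha>)) + (\<Sum>\<alpha>\<in>C' - ?C. norm (v \<alpha>))"
      by (intro order_trans[OF abs_triangle_ineq4] add_mono order_trans[OF sum_abs] sum_mono component_le_norm_cart)
    also have "\<dots> = (\<Sum>\<alpha>\<in>(?C - C') \<union> (C' - ?C). norm (v \<alpha>))"
      using fin by (intro sum.union_disjoint[symmetric]) auto
    also have "\<dots> \<le> (\<Sum>\<alpha>\<in>lattice_shell R. norm (v \<alpha>))"
    proof (rule sum_mono2[OF finite_lattice_shell])
      have "?C - C' \<subseteq> lattice_shell R"
      proof
        fix \<alpha> assume \<alpha>: "\<alpha> \<in> ?C - C'"
        have "\<alpha> + axis j 1 \<notin> ?C"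
          using \<alpha> by (force simp: C'_def)
        \<comment> \<open>A step in direction \<open>j\<close> leaves the cube only from the face
          where the coordinate equals \<open>R\<close>.\<close>
        moreover have "\<alpha> + axis j 1 \<in> ?C" if "\<alpha> $ j < int R"
        proof -
          have "- int R \<le> \<alpha> $ j"
            using \<alpha> by (auto simp: lattice_cube_def dest!: spec[of _ j])
          then show ?thesis
            using that \<alpha> by (auto simp: lattice_cube_def axis_def)
        qed
        ultimately have "\<alpha> $ j \<ge> int R"
          by linarith
        then have "\<alpha> \<notin> lattice_cube (R - 1)"
          using R by (auto simp: lattice_cube_def of_nat_diff intro!: exI[of _ j])
        then show "\<alpha> \<in> lattice_shell R"
          using \<alpha> lattice_cube_mono[of R "R + 1"] by (auto simp: lattice_shell_def)
      qed
      moreover have "C' \<subseteq> lattice_cube (R + 1)"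
      proof
        fix \<alpha> assume "\<alpha> \<in> C'"
        then obtain \<beta> where \<beta>: "\<beta> \<in> ?C" "\<alpha> = \<beta> - axis j 1" by (auto simp: C'_def)
        then have "- int R \<le> \<alpha> $ i \<and> \<alpha> $ i \<le> 1 + int R" for i
          by (auto simp: lattice_cube_def axis_def dest!: spec[of _ i])
        then show "\<alpha> \<in> lattice_cube (R + 1)"
          by (simp add: lattice_cube_def)
      qed
      then have "C' - ?C \<subseteq> lattice_shell R"
        using lattice_cube_mono[of "R - 1" R] by (auto simp: lattice_shell_def)
      ultimately show "(?C - C') \<union> (C' - ?C) \<subseteq> lattice_shell R" by blast
    qed simp
    finally show ?thesis .
  qed
  have "(\<Sum>\<alpha>\<in>?C. lattice_div v \<alpha>) = (\<Sum>j\<in>UNIV. \<Sum>\<alpha>\<in>?C. v \<alpha> $ j - v (\<alpha> - axis j 1) $ j)"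
    unfolding lattice_div_def by (rule sum.swap)
  also have "\<bar>\<dots>\<bar> \<le> (\<Sum>j\<in>(UNIV :: 'n set). \<Sum>\<alpha>\<in>lattice_shell R. norm (v \<alpha>))"
    by (intro order_trans[OF sum_abs] sum_mono one)
  finally show ?thesis by simp
qed

lemma ex_mem_lattice_cube: "\<exists>R. \<alpha> \<in> lattice_cube R"
proof -
  define r where "r = nat (\<Sum>i\<in>UNIV. \<bar>\<alpha> $ i\<bar>)"
  have "\<bar>\<alpha> $ j\<bar> \<le> (\<Sum>i\<in>UNIV. \<bar>\<alpha> $ i\<bar>)" for j
    by (rule member_le_sum) auto
  then have "\<bar>\<alpha> $ j\<bar> \<le> int r" for j
    by (simp add: r_def sum_nonneg)
  then have "- int r \<le> \<alpha> $ j \<and> \<alpha> $ j \<le> 1 + int r" for j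
    by (smt (verit))
  \<comment> \<open>The cube is asymmetric: its lower bound is - R + 1, so radius \<open>r\<close>
    would miss coordinates equal to - r.\<close>
  then have "\<alpha> \<in> lattice_cube (r + 1)"
    by (simp add: lattice_cube_def)
  then show ?thesis ..
qed

lemma card_lattice_shell:
  "real (card (lattice_shell R :: (int ^ 'n) set)) = (2 * real (R + 1)) ^ CARD('n) - (2 * real (R - 1)) ^ CARD('n)"
  using sum_lattice_shell[of "\<lambda>_ :: int ^ 'n. 1" R] by (simp add: card_lattice_cube)

section \<open>Dissipation and energy balance\<close>

lemma norm_le_sup_norm: "bounded (range g) \<Longrightarrow> norm (g \<alpha>) \<le> sup_norm g"
  unfolding sup_norm_def
  by (rule cSUP_upper) (auto simp: bdd_above_def bounded_iff)

text \<open>The choice c = 2 y / p turns the second term into p / 2, which is absorbed on the left.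
  Unlike the minimiser sqrt (y / x), it also makes sense for x = 0.\<close>

lemma square_le_of_weighted_sum_le:
  fixes p x y :: real
  assumes "\<And>c. c > 0 \<Longrightarrow> p \<le> c * x + y / c" and "p \<ge> 0" "x \<ge> 0" "y > 0"
  shows "p\<^sup>2 \<le> 4 * y * x"
proof (cases "p = 0")
  case False
  then have p: "p > 0" using assms by simp
  have "p \<le> (2 * y / p) * x + y / (2 * y / p)"
    using assms(1)[of "2 * y / p"] assms(4) p by simp
  also have "\<dots> = 2 * y * x / p + p / 2"
    using p assms(4) by simp
  finally have "p * p \<le> p * (2 * y * x / p + p / 2)"
    using p by simp
  then show ?thesis
    using p by (simp add: distrib_left power2_eq_square)
qed (use assms in simp)

context lattice_EDS
begin

section \<open>Orbits and uniform bounds on a compact time interval\<close>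

lemma orbit_in_space: "u \<in> topspace X \<Longrightarrow> t \<ge> 0 \<Longrightarrow> \<phi> u t \<in> topspace X"
  using semiflow continuous_map_funspace[of "prod_topology X (top_of_set {0..})" X "\<lambda>(u, t). \<phi> u t"]
  unfolding continuous_semiflow_def by (auto simp: Pi_iff)

lemma continuous_on_orbit:
  assumes u: "u \<in> topspace X" and F: "continuous_map X euclideanreal F"
  shows "continuous_on {0..} (\<lambda>t. F (\<phi> u t))"
proof -
  have "continuous_map (top_of_set {0..}) (prod_topology X (top_of_set {0..})) (\<lambda>t :: real. (u, t))"
    using u by (intro continuous_map_pairedI) auto
  moreover have "continuous_map (prod_topology X (top_of_set {0..})) X (\<lambda>(u, t). \<phi> u t)"
    using semiflow unfolding continuous_semiflow_def by blast
  ultimately have "continuous_map (top_of_set {0..}) euclideanreal (F \<circ> ((\<lambda>(u, t). \<phi> u t) \<circ> (\<lambda>t. (u, t))))"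
    by (intro continuous_map_compose[OF _ F] continuous_map_compose)
  then show ?thesis
    by (simp add: o_def continuous_map_iff_continuous)
qed

lemma continuous_on_d: "u \<in> topspace X \<Longrightarrow> continuous_on {0..} (\<lambda>t. d (\<phi> u t) \<alpha>)"
  and continuous_on_e: "u \<in> topspace X \<Longrightarrow> continuous_on {0..} (\<lambda>t. e (\<phi> u t) \<alpha>)"
  and continuous_on_f: "u \<in> topspace X \<Longrightarrow> continuous_on {0..} (\<lambda>t. f (\<phi> u t) \<alpha> $ j)"
  using continuous_on_orbit A2_d A2_e A2_f by blast+

lemma continuous_on_div:
  "u \<in> topspace X \<Longrightarrow> continuous_on {0..} (\<lambda>t. lattice_div (f (\<phi> u t)) \<alpha>)"
  unfolding lattice_div_def by (intro continuous_intros continuous_on_f)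

lemma dissipation_bounded:
  assumes u: "u \<in> topspace X"
  obtains M where "M > 0" "\<And>t \<alpha>. t \<in> {0..T} \<Longrightarrow> d (\<phi> u t) \<alpha> \<le> M"
proof -
  have "compact ((\<lambda>t. sup_norm (d (\<phi> u t))) ` {0..T})"
    by (intro compact_continuous_image continuous_on_subset[OF A2_norm_d[OF u]]) auto
  then obtain M where "\<forall>x\<in>(\<lambda>t. sup_norm (d (\<phi> u t))) ` {0..T}. norm x \<le> M"
    using compact_imp_bounded bounded_iff by metis
  then have M: "\<bar>sup_norm (d (\<phi> u t))\<bar> \<le> M" if "t \<in> {0..T}" for t
    using that by auto
  have "d (\<phi> u t) \<alpha> \<le> max M 1" if "t \<in> {0..T}" for t \<alpha>
    using norm_le_sup_norm[OF bounded_d[OF orbit_in_space[OF u, of t]], of \<alpha>] M[OF that] that by auto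
  then show ?thesis
    using that[of "max M 1"] by auto
qed

text \<open>On \<open>{0..T}\<close> the continuous sup norm of the energy is bounded by some
  \<open>M\<close>, so monotonicity of \<open>b\<close> makes the constant in \<open>A5\<close>
  uniform in time; the maximum with 1 makes it positive.\<close>

lemma flux_square_le_dissipation:
  assumes u: "u \<in> topspace X"
  obtains B where "B > 0" "\<And>t \<alpha>. t \<in> {0..T} \<Longrightarrow> (norm (f (\<phi> u t) \<alpha>))\<^sup>2 \<le> B * d (\<phi> u t) \<alpha>"
proof -
  obtain b :: "real \<Rightarrow> real" where b: "mono_on {0..} b"
    "\<And>u \<alpha>. u \<in> topspace X \<Longrightarrow> (norm (f u \<alpha>))\<^sup>2 \<le> b (sup_norm (e u)) * d u \<alpha>"
    using A5 by blast
  have "compact ((\<lambda>t. sup_norm (e (\<phi> u t))) ` {0..T})"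
    by (intro compact_continuous_image continuous_on_subset[OF A2_norm_e[OF u]]) auto
  then obtain M where "\<forall>x\<in>(\<lambda>t. sup_norm (e (\<phi> u t))) ` {0..T}. norm x \<le> M"
    using compact_imp_bounded bounded_iff by metis
  then have M: "\<bar>sup_norm (e (\<phi> u t))\<bar> \<le> M" if "t \<in> {0..T}" for t
    using that by auto
  have "(norm (f (\<phi> u t) \<alpha>))\<^sup>2 \<le> max (b M) 1 * d (\<phi> u t) \<alpha>" if t: "t \<in> {0..T}" for t \<alpha>
  proof -
    have X: "\<phi> u t \<in> topspace X" using orbit_in_space[OF u] t by simp
    have "0 \<le> sup_norm (e (\<phi> u t))"
      using norm_le_sup_norm[OF bounded_e[OF X]] norm_ge_zero order_trans by blast
    then have "b (sup_norm (e (\<phi> u t))) \<le> b M"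
      using M[OF t] by (intro mono_onD[OF b(1)]) auto
    then have "b (sup_norm (e (\<phi> u t))) * d (\<phi> u t) \<alpha> \<le> max (b M) 1 * d (\<phi> u t) \<alpha>"
      using A1[OF X] by (intro mult_right_mono) auto
    then show ?thesis using b(2)[OF X, of \<alpha>] by linarith
  qed
  then show ?thesis
    using that[of "max (b M) 1"] by auto
qed

section \<open>Dissipation integrated over time\<close>

definition dissipation :: "'a \<Rightarrow> real \<Rightarrow> (int ^ 'n) set \<Rightarrow> real" where
  "dissipation u T A = integral {0..T} (\<lambda>t. \<Sum>\<alpha>\<in>A. d (\<phi> u t) \<alpha>)"

lemma integrable_dissipation:
  "u \<in> topspace X \<Longrightarrow> (\<lambda>t. \<Sum>\<alpha>\<in>A. d (\<phi> u t) \<alpha>) integrable_on {0..T}"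
  by (intro integrable_continuous_interval continuous_intros
      continuous_on_subset[OF continuous_on_d]) auto

lemma dissipation_mono:
  assumes "u \<in> topspace X" "finite B" "A \<subseteq> B"
  shows "dissipation u T A \<le> dissipation u T B"
  unfolding dissipation_def
proof (intro integral_le integrable_dissipation assms(1))
  fix t assume "t \<in> {0..T}"
  then show "(\<Sum>\<alpha>\<in>A. d (\<phi> u t) \<alpha>) \<le> (\<Sum>\<alpha>\<in>B. d (\<phi> u t) \<alpha>)"
    using assms A1[OF orbit_in_space[OF assms(1)]] by (intro sum_mono2) auto
qed

lemma dissipation_nonneg: "u \<in> topspace X \<Longrightarrow> dissipation u T A \<ge> 0"
  unfolding dissipation_def
  by (intro integral_nonneg integrable_dissipation sum_nonneg) (auto simp: A1 orbit_in_space)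

lemma dissipation_le_card:
  assumes u: "u \<in> topspace X" and T: "T > 0"
  obtains K where "K > 0" "\<And>A. dissipation u T A \<le> K * real (card A)"
proof -
  obtain M where M: "M > 0" "\<And>t \<alpha>. t \<in> {0..T} \<Longrightarrow> d (\<phi> u t) \<alpha> \<le> M"
    using dissipation_bounded[OF u] by blast
  have "dissipation u T A \<le> (M * T) * real (card A)" for A
  proof -
    have "dissipation u T A \<le> integral {0..T} (\<lambda>t. real (card A) * M)"
      unfolding dissipation_def using M(2)
      by (intro integral_le integrable_dissipation u sum_bounded_above integrable_const_ivl)
    then show ?thesis using T by (simp add: mult_ac)
  qed
  then show ?thesis using that M T by (metis mult_pos_pos)
qed

lemma dissipation_shell:
  assumes "u \<in> topspace X"
  shows "dissipation u T (lattice_shell R) =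
    dissipation u T (lattice_cube (R + 1)) - dissipation u T (lattice_cube (R - 1))"
  unfolding dissipation_def sum_lattice_shell
  by (intro integral_diff integrable_dissipation assms)

text \<open>By \<open>A3\<close> some site dissipates at time 0. Its dissipation is continuous and
  nonnegative in time, so a zero integral would force it to vanish at time 0 too.\<close>

lemma dissipation_pos:
  assumes u: "u \<in> topspace X" and "\<not> stationary \<phi> u" and T: "T > 0"
  shows "\<exists>R. dissipation u T (lattice_cube R) > 0"
proof -
  obtain \<alpha> where \<alpha>: "d u \<alpha> \<noteq> 0" using A3[OF u] assms(2) by blast
  obtain R where R: "\<alpha> \<in> lattice_cube R" using ex_mem_lattice_cube by blast
  have u0: "\<phi> u 0 = u" using semiflow u unfolding continuous_semiflow_def by blast
  have cont: "continuous_on {0..T} (\<lambda>t. \<Sum>\<alpha>\<in>{\<alpha>}. d (\<phi> u t) \<alpha>)"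
    by (intro continuous_intros continuous_on_subset[OF continuous_on_d[OF u]]) auto
  have "dissipation u T {\<alpha>} \<noteq> 0"
  proof
    assume "dissipation u T {\<alpha>} = 0"
    then have "\<forall>t\<in>{0..T}. (\<Sum>\<alpha>\<in>{\<alpha>}. d (\<phi> u t) \<alpha>) = 0"
      using cont T u unfolding dissipation_def
      by (subst (asm) integral_eq_0_iff) (auto simp: A1 orbit_in_space)
    from this[rule_format, of 0] show False using \<alpha> T u0 by simp
  qed
  then have "0 < dissipation u T {\<alpha>}" using dissipation_nonneg[OF u, of T "{\<alpha>}"] by linarith
  also have "\<dots> \<le> dissipation u T (lattice_cube R)"
    using R by (intro dissipation_mono[OF u] finite_lattice_cube) auto
  finally show ?thesis ..
qed

section \<open>Energy balance and flux estimate on cubes\<close>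

lemma cube_energy_balance:
  assumes u: "u \<in> topspace X" and T: "T > 0"
  shows "integral {0..T} (\<lambda>t. \<Sum>\<alpha>\<in>lattice_cube R. lattice_div (f (\<phi> u t)) \<alpha>)
    = cube_energy \<phi> e u R T - cube_energy \<phi> e u R 0 + dissipation u T (lattice_cube R)"
proof -
  let ?h = "\<lambda>\<alpha> t. - d (\<phi> u t) \<alpha> + lattice_div (f (\<phi> u t)) \<alpha>"
  have h: "continuous_on {0..} (?h \<alpha>)" for \<alpha>
    by (intro continuous_intros continuous_on_d continuous_on_div u)
  have "integral {0..T} (?h \<alpha>) = e (\<phi> u T) \<alpha> - e (\<phi> u 0) \<alpha>" for \<alpha>
    by (rule distributional_derivative_FTC[OF A4[OF u] continuous_on_e[OF u] h T])
  moreover have int: "?h \<alpha> integrable_on {0..T}" for \<alpha>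
    by (intro integrable_continuous_interval continuous_on_subset[OF h]) auto
  ultimately have "(?h \<alpha> has_integral e (\<phi> u T) \<alpha> - e (\<phi> u 0) \<alpha>) {0..T}" for \<alpha>
    by (metis integrable_integral)
  then have "((\<lambda>t. \<Sum>\<alpha>\<in>lattice_cube R. ?h \<alpha> t) has_integral
      (\<Sum>\<alpha>\<in>lattice_cube R. e (\<phi> u T) \<alpha> - e (\<phi> u 0) \<alpha>)) {0..T}"
    by (intro has_integral_sum finite_lattice_cube)
  from has_integral_add[OF this integrable_integral[OF integrable_dissipation[OF u, of "lattice_cube R"]]]
  show ?thesis
    by (intro integral_unique)
      (simp add: cube_energy_def dissipation_def sum.distrib sum_negf sum_subtractf)
qed

text \<open>The energy balance bounds the dissipation in the cube by the flux through its boundary,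
  and \<open>A5\<close> bounds that flux by dissipation in the shell. \<open>S\<close> stands for
  any positive upper bound of the shell size.\<close>

lemma dissipation_square_le:
  assumes u: "u \<in> topspace X" and T: "T > 0"
  obtains K where "K > 0" "\<And>R S. R \<in> nondecreasing_radii \<phi> e u T \<Longrightarrow>
    real (card (lattice_shell R :: (int ^ 'n) set)) \<le> S \<Longrightarrow> S > 0 \<Longrightarrow>
    (dissipation u T (lattice_cube R))\<^sup>2 \<le> K * S * dissipation u T (lattice_shell R)"
proof -
  obtain B where B: "B > 0"
    "\<And>t \<alpha>. t \<in> {0..T} \<Longrightarrow> (norm (f (\<phi> u t) \<alpha>))\<^sup>2 \<le> B * d (\<phi> u t) \<alpha>"
    using flux_square_le_dissipation[OF u] by blast
  define N where "N = real CARD('n)"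
  have N: "N > 0" by (simp add: N_def)
  have main: "(dissipation u T (lattice_cube R))\<^sup>2 \<le> (4 * N\<^sup>2 * B * T) * S * dissipation u T (lattice_shell R)"
    if R: "R \<in> nondecreasing_radii \<phi> e u T"
      and S: "real (card (lattice_shell R :: (int ^ 'n) set)) \<le> S" "S > 0" for R S
  proof -
    let ?C = "lattice_cube R :: (int ^ 'n) set" and ?S = "lattice_shell R :: (int ^ 'n) set"
    have R1: "R \<ge> 1" and J: "cube_energy \<phi> e u R T \<ge> cube_energy \<phi> e u R 0"
      using R by (auto simp: nondecreasing_radii_def)
    have "dissipation u T ?C \<le> c * (N * dissipation u T ?S) + (N * B * S * T) / c" if c: "c > 0" for c
    proof -
      \<comment> \<open>A weighted AM-GM inequality with a free constant \<open>c\<close>, optimised only after integrating in time,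
        replaces the Cauchy-Schwarz inequality in space-time.\<close>
      have pointwise: "(\<Sum>\<alpha>\<in>?C. lattice_div (f (\<phi> u t)) \<alpha>)
          \<le> c * N * (\<Sum>\<alpha>\<in>?S. d (\<phi> u t) \<alpha>) + N * B * S / c" if t: "t \<in> {0..T}" for t
      proof -
        have "norm (f (\<phi> u t) \<alpha>) \<le> c * d (\<phi> u t) \<alpha> + B / c" for \<alpha>
        proof (rule power2_le_imp_le)
          have d: "d (\<phi> u t) \<alpha> \<ge> 0" using A1[OF orbit_in_space[OF u]] t by simp
          \<comment> \<open>The squares of the sum and the difference of c d and B / c differ by 4 B
            d, which dominates the bound B d on the squared flux.\<close>
          have "0 \<le> (c * d (\<phi> u t) \<alpha> - B / c)\<^sup>2" by simp
          then have "4 * B * d (\<phi> u t) \<alpha> \<le> (c * d (\<phi> u t) \<alpha> + B / c)\<^sup>2"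
            using c by (simp add: power2_eq_square field_simps)
          moreover have "0 \<le> B * d (\<phi> u t) \<alpha>" using B d by simp
          ultimately show "(norm (f (\<phi> u t) \<alpha>))\<^sup>2 \<le> (c * d (\<phi> u t) \<alpha> + B / c)\<^sup>2"
            using B(2)[OF t, of \<alpha>] by linarith
          show "0 \<le> c * d (\<phi> u t) \<alpha> + B / c" using c B d by simp
        qed
        then have "(\<Sum>\<alpha>\<in>?S. norm (f (\<phi> u t) \<alpha>)) \<le> (\<Sum>\<alpha>\<in>?S. c * d (\<phi> u t) \<alpha> + B / c)"
          by (rule sum_mono)
        also have "\<dots> = c * (\<Sum>\<alpha>\<in>?S. d (\<phi> u t) \<alpha>) + real (card ?S) * (B / c)"
          by (simp add: sum.distrib sum_distrib_left)
        also have "\<dots> \<le> c * (\<Sum>\<alpha>\<in>?S. d (\<phi> u t) \<alpha>) + S * (B / c)"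
          using S B c by (intro add_left_mono mult_right_mono) auto
        finally have "N * (\<Sum>\<alpha>\<in>?S. norm (f (\<phi> u t) \<alpha>)) \<le> N * (c * (\<Sum>\<alpha>\<in>?S. d (\<phi> u t) \<alpha>) + S * (B / c))"
          using N by (intro mult_left_mono) auto
        then show ?thesis
          using abs_sum_lattice_div_le[OF R1, of "f (\<phi> u t)"] by (simp add: N_def algebra_simps)
      qed
      \<comment> \<open>The energy difference in the balance is nonnegative because \<open>R\<close>
        is a radius without energy loss.\<close>
      have "dissipation u T ?C \<le> integral {0..T} (\<lambda>t. \<Sum>\<alpha>\<in>?C. lattice_div (f (\<phi> u t)) \<alpha>)"
        using cube_energy_balance[OF u T, of R] J by simp
      also have "\<dots> \<le> integral {0..T} (\<lambda>t. c * N * (\<Sum>\<alpha>\<in>?S. d (\<phi> u t) \<alpha>) + N * B * S / c)"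
      proof (rule integral_le[OF _ _ pointwise])
        show "(\<lambda>t. \<Sum>\<alpha>\<in>?C. lattice_div (f (\<phi> u t)) \<alpha>) integrable_on {0..T}"
          by (intro integrable_continuous_interval continuous_intros
              continuous_on_subset[OF continuous_on_div[OF u]]) auto
        show "(\<lambda>t. c * N * (\<Sum>\<alpha>\<in>?S. d (\<phi> u t) \<alpha>) + N * B * S / c) integrable_on {0..T}"
          by (intro integrable_continuous_interval continuous_intros
              continuous_on_subset[OF continuous_on_d[OF u]]) auto
      qed
      also have "\<dots> = c * N * dissipation u T ?S + T * (N * B * S / c)"
      proof (rule integral_unique)
        have "((\<lambda>t. N * B * S / c) has_integral T * (N * B * S / c)) {0..T}"
          using has_integral_const_real[of "N * B * S / c" 0 T] T by simp
        then show "((\<lambda>t. c * N * (\<Sum>\<alpha>\<in>?S. d (\<phi> u t) \<alpha>) + N * B * S / c) has_integral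
            c * N * dissipation u T ?S + T * (N * B * S / c)) {0..T}"
          unfolding dissipation_def
          by (intro has_integral_add has_integral_mult_right integrable_integral integrable_dissipation u)
      qed
      finally show ?thesis by (simp add: mult_ac)
    qed
    then have "(dissipation u T ?C)\<^sup>2 \<le> 4 * (N * B * S * T) * (N * dissipation u T ?S)"
      by (rule square_le_of_weighted_sum_le)
        (use u N B S T in \<open>auto intro!: dissipation_nonneg mult_nonneg_nonneg mult_pos_pos\<close>)
    then show ?thesis by (simp add: power2_eq_square mult_ac)
  qed
  show ?thesis
    by (rule that[OF _ main]) (use N B T in simp_all)
qed

end

section \<open>Conclusion in dimensions one and two\<close>

theorem theorem1:
  fixes X :: "'a topology"
    and \<phi> :: "'a \<Rightarrow> real \<Rightarrow> 'a"
    and e d :: "'a \<Rightarrow> int ^ 'n \<Rightarrow> real"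
    and f :: "'a \<Rightarrow> int ^ 'n \<Rightarrow> real ^ 'n"
    and u :: 'a and T :: real
  assumes "lattice_EDS X \<phi> e d f"
    and "u \<in> topspace X"
    and "\<not> stationary \<phi> u"
    and "T > 0"
  shows "(CARD('n) = 1 \<longrightarrow> finite (nondecreasing_radii \<phi> e u T)) \<and>
         (CARD('n) = 2 \<longrightarrow> (\<lambda>r. 1 / real r) summable_on nondecreasing_radii \<phi> e u T)"
proof -
  interpret lattice_EDS X \<phi> e d f by fact
  note u = \<open>u \<in> topspace X\<close> and T = \<open>T > 0\<close>
  define a where "a R = dissipation u T (lattice_cube R)" for R
  let ?S = "\<lambda>R. lattice_shell R :: (int ^ 'n) set" and ?J = "nondecreasing_radii \<phi> e u T"
  have mono: "mono a"
    unfolding a_def by (intro monoI dissipation_mono u finite_lattice_cube lattice_cube_mono)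
  obtain R0 where R0: "a R0 > 0"
    unfolding a_def using dissipation_pos[OF u assms(3) T] by blast
  have shell: "dissipation u T (?S R) = a (R + 1) - a (R - 1)" for R
    by (simp add: a_def dissipation_shell u)
  obtain K1 where K1: "K1 > 0" "\<And>A. dissipation u T A \<le> K1 * real (card A)"
    using dissipation_le_card[OF u T] by blast
  obtain K2 where K2: "K2 > 0" "\<And>R S. R \<in> ?J \<Longrightarrow> real (card (?S R)) \<le> S \<Longrightarrow> S > 0 \<Longrightarrow>
      (a R)\<^sup>2 \<le> K2 * S * (a (R + 1) - a (R - 1))"
    using dissipation_square_le[OF u T] unfolding shell a_def by blast
  \<comment> \<open>One constant for both dimensions: the shells have 4 and 16 R sites, and in the
    plane the cube of radius R + 1 has at most 16 R^2.\<close>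
  define K where "K = 16 * (K1 + K2)"
  have K: "K > 0" using K1 K2 by (simp add: K_def)
  have J: "R \<ge> 1" if "R \<in> ?J" for R
    using that by (simp add: nondecreasing_radii_def)
  have incr: "a (R + 1) - a (R - 1) \<ge> 0" for R
    using monoD[OF mono, of "R - 1" "R + 1"] by simp
  show ?thesis
  proof (intro conjI impI)
    assume N: "CARD('n) = 1"
    have card: "real (card (?S R)) = 4" if "R \<in> ?J" for R
      using J[OF that] by (simp add: card_lattice_shell N of_nat_diff)
    show "finite ?J"
    proof (rule finite_of_recurrent_growth[OF mono R0 K])
      fix R assume R: "R \<in> ?J"
      have "(a R)\<^sup>2 \<le> K2 * 4 * (a (R + 1) - a (R - 1))"
        by (rule K2(2)[OF R]) (simp_all add: card[OF R])
      also have "\<dots> \<le> K * (a (R + 1) - a (R - 1))"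
        using incr[of R] K1 K2 by (intro mult_right_mono) (auto simp: K_def)
      finally show "(a R)\<^sup>2 \<le> K * (a (R + 1) - a (R - 1))" .
      show "a (R + 1) - a (R - 1) \<le> K"
        using K1(2)[of "?S R"] K1 K2 by (simp add: shell card[OF R] K_def)
    qed
  next
    assume N: "CARD('n) = 2"
    have card: "real (card (?S R)) = 16 * real R" if "R \<in> ?J" for R
      using J[OF that] by (simp add: card_lattice_shell N of_nat_diff power2_eq_square algebra_simps)
    show "(\<lambda>r. 1 / real r) summable_on ?J"
    proof (rule summable_on_inverse_of_recurrent_growth[OF mono R0 K])
      fix R assume R: "R \<in> ?J"
      have "(a R)\<^sup>2 \<le> K2 * (16 * real R) * (a (R + 1) - a (R - 1))"
        by (rule K2(2)[OF R]) (use J[OF R] in \<open>simp_all add: card[OF R]\<close>)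
      also have "\<dots> \<le> K * real R * (a (R + 1) - a (R - 1))"
        using incr[of R] K1 K2 by (intro mult_right_mono) (auto simp: K_def algebra_simps)
      finally show "R \<ge> 1 \<and> (a R)\<^sup>2 \<le> K * real R * (a (R + 1) - a (R - 1))"
        using J[OF R] by blast
      \<comment> \<open>The cube of radius R + 1 has side 2 (R + 1), which is at most 4 R because R
        \<ge> 1.\<close>
      have "a (R + 1) \<le> K1 * (2 * (real R + 1))\<^sup>2"
        using K1(2)[of "lattice_cube (R + 1)"] by (simp add: a_def card_lattice_cube N add.commute)
      also have "\<dots> \<le> K1 * (4 * real R)\<^sup>2"
        using K1 J[OF R] by (intro mult_left_mono power_mono) auto
      also have "\<dots> \<le> K * (real R)\<^sup>2"
        using K2 by (simp add: K_def power_mult_distrib algebra_simps)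
      finally show "a (R + 1) \<le> K * (real R)\<^sup>2" .
    qed
  qed
qed

end
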